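(* Suppose $f(x,z)\in(\mathbb{C}\langle\langle x_1,\dots,x_g,z_1,\dots,z_h\rangle\rangle)^h$. If $f(0,0)=0$ and $\frac{\partial f}{\partial z}(0,0)\in M_h(\mathbb{C})$ is invertible, then there exists a unique $\mathfrak{g}\in(\mathbb{C}\langle\langle x_1,\dots,x_g\rangle\rangle)^h$ such that $\mathfrak{g}(0)=0$ and $f(x,\mathfrak{g}(x))=0$.
   Context: $x=(x_1,\dots,x_g)$ and $z=(z_1,\dots,z_h)$ are freely noncommuting indeterminates. $\mathbb{C}\langle\langle x_1,\dots,x_g\rangle\rangle$ is the algebra of formal power series $\sum_w c_w w$, $c_w\in\mathbb{C}$, over all words $w$ in the noncommuting letters, and similarly for the letters $x_1,\dots,x_g,z_1,\dots,z_h$. For a formal power series, evaluation at $0$ means taking the constant term (the coefficient of the empty word). The free derivative $D$ is the linear, continuous operator on formal power series satisfying the Leibniz rule $D(\eta\mu)=D\eta\cdot\mu+\eta\cdot D\mu$ and sending each indeterminate to its direction variable; for $f_i=f_i(x,z)$, $Df_i(x,z)[0,e_j]$ denotes the derivative in the direction $0$ for $x$ and $e_j$ (the $j$-th standard vector) for $z$. Define $\frac{\partial f}{\partial z}=\big(Df_i(x,z)[0,e_j]\big)_{i,j=1}^h\in M_h(\mathbb{C}\langle\langle x_1,\dots,x_g,z_1,\dots,z_h\rangle\rangle)$; thus the $(i,j)$ entry of $\frac{\partial f}{\partial z}(0,0)$ is the coefficient of the monomial $z_j$ in $f_i$. *)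

theory Defs
  imports "HOL-Analysis.Analysis" "HOL-Library.Groups_Big_Fun"
begin

section \<open>Formal power series in freely noncommuting letters\<close>

text \<open>A series over the letters of type \<open>'a\<close> is its family of coefficients, indexed by the words
  \<open>'a list\<close>; multiplication is the Cauchy product over all factorisations of a word.\<close>

typedef 'a ncps = "UNIV :: ('a list \<Rightarrow> complex) set"
  morphisms nc_coeff Abs_ncps ..

lemma nc_coeff_Abs [simp]: "nc_coeff (Abs_ncps f) = f"
  by (simp add: Abs_ncps_inverse)

lemma ncps_eqI: "(\<And>w. nc_coeff f w = nc_coeff g w) \<Longrightarrow> f = g"
  by (metis nc_coeff_inject ext)

lemma ncps_eq_iff: "f = g \<longleftrightarrow> (\<forall>w. nc_coeff f w = nc_coeff g w)"
  using ncps_eqI by blast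

lemma nc_sum_split_assoc:
  fixes F :: "'a list \<Rightarrow> 'a list \<Rightarrow> 'a list \<Rightarrow> complex"
  shows "(\<Sum>i\<le>length w. \<Sum>j\<le>i. F (take j w) (take (i - j) (drop j w)) (drop i w))
       = (\<Sum>j\<le>length w. \<Sum>k\<le>length w - j. F (take j w) (take k (drop j w)) (drop (j + k) w))"
  unfolding sum.Sigma[OF finite_atMost ballI[OF finite_atMost]]
  by (rule sum.reindex_bij_witness[where j = "\<lambda>(i, j). (j, i - j)" and i = "\<lambda>(j, k). (j + k, j)"])
     auto

instantiation ncps :: (type) ring_1
begin

definition zero_ncps :: "'a ncps" where
  "0 = Abs_ncps (\<lambda>_. 0)"

definition one_ncps :: "'a ncps" where
  "1 = Abs_ncps (\<lambda>w. if w = [] then 1 else 0)"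

definition plus_ncps :: "'a ncps \<Rightarrow> 'a ncps \<Rightarrow> 'a ncps" where
  "f + g = Abs_ncps (\<lambda>w. nc_coeff f w + nc_coeff g w)"

definition minus_ncps :: "'a ncps \<Rightarrow> 'a ncps \<Rightarrow> 'a ncps" where
  "f - g = Abs_ncps (\<lambda>w. nc_coeff f w - nc_coeff g w)"

definition uminus_ncps :: "'a ncps \<Rightarrow> 'a ncps" where
  "- f = Abs_ncps (\<lambda>w. - nc_coeff f w)"

definition times_ncps :: "'a ncps \<Rightarrow> 'a ncps \<Rightarrow> 'a ncps" where
  "f * g = Abs_ncps (\<lambda>w. \<Sum>i\<le>length w. nc_coeff f (take i w) * nc_coeff g (drop i w))"

instance
proof
  fix a b c :: "'a ncps"
  show "a * b * c = a * (b * c)"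
  proof (rule ncps_eqI)
    fix w
    have "nc_coeff (a * b * c) w =
        (\<Sum>i\<le>length w. \<Sum>j\<le>i. nc_coeff a (take j w) * nc_coeff b (take (i - j) (drop j w))
            * nc_coeff c (drop i w))"
      by (auto simp: times_ncps_def sum_distrib_right min_def drop_take intro!: sum.cong)
    also have "\<dots> = (\<Sum>j\<le>length w. \<Sum>k\<le>length w - j. nc_coeff a (take j w)
            * nc_coeff b (take k (drop j w)) * nc_coeff c (drop (j + k) w))"
      by (rule nc_sum_split_assoc[where F = "\<lambda>x y z. nc_coeff a x * nc_coeff b y * nc_coeff c z"])
    also have "\<dots> = nc_coeff (a * (b * c)) w"
      by (auto simp: times_ncps_def sum_distrib_left mult.assoc add.commute intro!: sum.cong)
    finally show "nc_coeff (a * b * c) w = nc_coeff (a * (b * c)) w" .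
  qed
  show "1 * a = a"
  proof (rule ncps_eqI)
    fix w
    have "nc_coeff (1 * a) w = (\<Sum>i\<le>length w. if i = 0 then nc_coeff a w else 0)"
      unfolding times_ncps_def one_ncps_def nc_coeff_Abs by (rule sum.cong) auto
    then show "nc_coeff (1 * a) w = nc_coeff a w" by simp
  qed
  show "a * 1 = a"
  proof (rule ncps_eqI)
    fix w
    have "nc_coeff (a * 1) w = (\<Sum>i\<le>length w. if i = length w then nc_coeff a w else 0)"
      unfolding times_ncps_def one_ncps_def nc_coeff_Abs by (rule sum.cong) auto
    then show "nc_coeff (a * 1) w = nc_coeff a w" by simp
  qed
  show "(0 :: 'a ncps) \<noteq> 1"
    by (auto simp: ncps_eq_iff zero_ncps_def one_ncps_def)
qed (auto simp: ncps_eq_iff plus_ncps_def minus_ncps_def uminus_ncps_def zero_ncps_def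
       times_ncps_def algebra_simps sum.distrib)

end

lemma nc_coeff_zero [simp]: "nc_coeff 0 w = 0"
  by (simp add: zero_ncps_def)

lemma nc_coeff_one: "nc_coeff 1 w = (if w = [] then 1 else 0)"
  by (simp add: one_ncps_def)

lemma nc_coeff_add [simp]: "nc_coeff (f + g) w = nc_coeff f w + nc_coeff g w"
  by (simp add: plus_ncps_def)

lemma nc_coeff_diff [simp]: "nc_coeff (f - g) w = nc_coeff f w - nc_coeff g w"
  by (simp add: minus_ncps_def)

lemma nc_coeff_uminus [simp]: "nc_coeff (- f) w = - nc_coeff f w"
  by (simp add: uminus_ncps_def)

lemma nc_coeff_times:
  "nc_coeff (f * g) w = (\<Sum>i\<le>length w. nc_coeff f (take i w) * nc_coeff g (drop i w))"
  by (simp add: times_ncps_def)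

lemma nc_coeff_sum [simp]: "nc_coeff (sum F A) w = (\<Sum>a\<in>A. nc_coeff (F a) w)"
  by (induction A rule: infinite_finite_induct) auto

definition nc_const :: "complex \<Rightarrow> 'a ncps" where
  "nc_const c = Abs_ncps (\<lambda>w. if w = [] then c else 0)"

definition nc_var :: "'a \<Rightarrow> 'a ncps" where
  "nc_var a = Abs_ncps (\<lambda>w. if w = [a] then 1 else 0)"

text \<open>Evaluation at \<open>0\<close>.\<close>

definition nc_eval0 :: "'a ncps \<Rightarrow> complex" where
  "nc_eval0 f = nc_coeff f []"

lemma nc_coeff_const: "nc_coeff (nc_const c) w = (if w = [] then c else 0)"
  by (simp add: nc_const_def)

lemma nc_coeff_var: "nc_coeff (nc_var a) w = (if w = [a] then 1 else 0)"
  by (simp add: nc_var_def)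

lemma nc_const_1 [simp]: "nc_const 1 = 1"
  by (simp add: nc_const_def one_ncps_def)

lemma nc_coeff_const_times [simp]: "nc_coeff (nc_const c * f) w = c * nc_coeff f w"
proof -
  have "nc_coeff (nc_const c * f) w = (\<Sum>i\<le>length w. if i = 0 then c * nc_coeff f w else 0)"
    unfolding nc_coeff_times nc_coeff_const by (rule sum.cong) auto
  then show ?thesis by simp
qed

lemma nc_coeff_var_times_Nil [simp]: "nc_coeff (nc_var a * f) [] = 0"
  by (simp add: nc_coeff_times nc_coeff_var)

lemma nc_coeff_var_times_Cons [simp]:
  "nc_coeff (nc_var a * f) (b # w) = (if b = a then nc_coeff f w else 0)"
proof -
  have "nc_coeff (nc_var a * f) (b # w)
      = (\<Sum>i\<le>Suc (length w). if i = 1 then (if b = a then nc_coeff f w else 0) else 0)"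
    unfolding nc_coeff_times
    by (rule sum.cong) (auto simp: nc_coeff_var take_Cons' drop_Cons')
  then show ?thesis by (auto simp: Suc_le_eq)
qed

lemma nc_coeff_monom_times:
  "nc_coeff (prod_list (map nc_var u) * f) w
     = (if take (length u) w = u then nc_coeff f (drop (length u) w) else 0)"
proof (induction u arbitrary: w)
  case (Cons a u)
  then show ?case by (cases w) (auto simp: mult.assoc)
qed auto

lemma nc_coeff_monom: "nc_coeff (prod_list (map nc_var u)) w = (if w = u then 1 else 0)"
proof -
  have "take (length u) w = u \<and> drop (length u) w = [] \<longleftrightarrow> w = u"
    by auto
  then show ?thesis
    using nc_coeff_monom_times[of u 1 w] by (auto simp: nc_coeff_one)
qed

section \<open>Substitution\<close>

text \<open>The series \<open>s a\<close> is substituted for each letter \<open>a\<close>.  The sum over all words is meant only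
  where it is locally finite, i.e. where each coefficient receives finitely many nonzero
  contributions; this holds if all \<open>s a\<close> have zero constant term
  (\<open>nc_subst_locally_finite\<close>).  Otherwise the coefficient is the junk value \<open>0\<close>.\<close>

definition nc_subst :: "'a ncps \<Rightarrow> ('a \<Rightarrow> 'b ncps) \<Rightarrow> 'b ncps" where
  "nc_subst f s = Abs_ncps (\<lambda>w. Sum_any (\<lambda>u. nc_coeff f u * nc_coeff (prod_list (map s u)) w))"

lemma nc_coeff_prod_list_eq_0:
  assumes "\<And>a. nc_eval0 (s a) = 0" and "length w < length u"
  shows "nc_coeff (prod_list (map s u)) w = 0"
  using assms(2)
proof (induction u arbitrary: w)
  case (Cons a u)
  have "nc_coeff (s a) (take i w) * nc_coeff (prod_list (map s u)) (drop i w) = 0"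
    if "i \<le> length w" for i
  proof (cases "i = 0")
    case True
    then show ?thesis using assms(1)[of a] by (simp add: nc_eval0_def)
  next
    case False
    then have "length (drop i w) < length u" using Cons.prems that by auto
    then show ?thesis using Cons.IH by simp
  qed
  then show ?case by (auto simp: nc_coeff_times intro!: sum.neutral)
qed auto

lemma finite_words_length_le: "finite {u :: 'a::finite list. length u \<le> n}"
  using finite_lists_length_le[of "UNIV :: 'a set" n] by simp

lemma nc_subst_locally_finite:
  fixes f :: "'a::finite ncps"
  assumes "\<And>a. nc_eval0 (s a) = 0"
  shows "finite {u. nc_coeff f u * nc_coeff (prod_list (map s u)) w \<noteq> 0}"
proof (rule finite_subset[OF _ finite_words_length_le])
  show "{u. nc_coeff f u * nc_coeff (prod_list (map s u)) w \<noteq> 0} \<subseteq> {u. length u \<le> length w}"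
    using nc_coeff_prod_list_eq_0[of s w] assms by (auto simp: not_less[symmetric])
qed

lemma nc_coeff_subst:
  fixes f :: "'a::finite ncps"
  assumes "\<And>a. nc_eval0 (s a) = 0"
  shows "nc_coeff (nc_subst f s) w
       = (\<Sum>u | length u \<le> length w. nc_coeff f u * nc_coeff (prod_list (map s u)) w)"
  unfolding nc_subst_def nc_coeff_Abs
proof (rule Sum_any.expand_superset[OF finite_words_length_le])
  show "{u. nc_coeff f u * nc_coeff (prod_list (map s u)) w \<noteq> 0} \<subseteq> {u. length u \<le> length w}"
    using nc_coeff_prod_list_eq_0[of s w] assms by (auto simp: not_less[symmetric])
qed

section \<open>The free derivative\<close>

text \<open>The derivative of a series in the letters \<open>'a\<close> is a series in the letters \<open>'a + 'a\<close>: \<open>Inl a\<close> is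
  the indeterminate \<open>a\<close> itself and \<open>Inr a\<close> is its direction variable.  By the Leibniz rule a word
  \<open>a\<^sub>1 \<dots> a\<^sub>n\<close> goes to the sum of the \<open>n\<close> words in which exactly one \<open>a\<^sub>k\<close> is replaced by its direction
  variable, hence the formula below.  That this is the unique linear continuous operator with the
  Leibniz rule and the right values on the letters is \<open>is_free_derivation_iff\<close>.\<close>

definition num_dirs :: "('a + 'a) list \<Rightarrow> nat" where
  "num_dirs u = length (filter (\<lambda>a. \<not> isl a) u)"

definition free_deriv :: "'a ncps \<Rightarrow> ('a + 'a) ncps" where
  "free_deriv f = Abs_ncps (\<lambda>u. if num_dirs u = 1 then nc_coeff f (map (case_sum id id) u) else 0)"

text \<open>The inclusion of the series in the indeterminates into the series in indeterminates and
  direction variables.\<close>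

definition nc_embed :: "'a ncps \<Rightarrow> ('a + 'a) ncps" where
  "nc_embed f = Abs_ncps (\<lambda>u. if num_dirs u = 0 then nc_coeff f (map (case_sum id id) u) else 0)"

text \<open>Continuity refers to the topology in which the series without terms of degree less than \<open>N\<close>
  form a neighbourhood base of \<open>0\<close>.\<close>

definition is_free_derivation :: "('a ncps \<Rightarrow> ('a + 'a) ncps) \<Rightarrow> bool" where
  "is_free_derivation D \<longleftrightarrow>
     (\<forall>f g. D (f + g) = D f + D g) \<and>
     (\<forall>c f. D (nc_const c * f) = nc_const c * D f) \<and>
     (\<forall>N. \<exists>M. \<forall>f. (\<forall>w. length w < M \<longrightarrow> nc_coeff f w = 0) \<longrightarrow>
                    (\<forall>u. length u < N \<longrightarrow> nc_coeff (D f) u = 0)) \<and>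
     (\<forall>f g. D (f * g) = D f * nc_embed g + nc_embed f * D g) \<and>
     (\<forall>a. D (nc_var a) = nc_var (Inr a))"

lemma num_dirs_simps [simp]:
  "num_dirs [] = 0" "num_dirs (Inl a # u) = num_dirs u" "num_dirs (Inr a # u) = Suc (num_dirs u)"
  "num_dirs (u @ v) = num_dirs u + num_dirs v"
  by (auto simp: num_dirs_def)

lemma num_dirs_map_Inl [simp]: "num_dirs (map Inl p) = 0"
  by (induction p) auto

lemma num_dirs_eq_0: "num_dirs u = 0 \<Longrightarrow> \<exists>p. u = map Inl p"
proof (induction u)
  case (Cons a u)
  then obtain b p where "a = Inl b" "u = map Inl p" by (cases a) auto
  then have "a # u = map Inl (b # p)" by simp
  then show ?case by (rule exI)
qed auto

lemma num_dirs_eq_1: "num_dirs u = 1 \<Longrightarrow> \<exists>p a q. u = map Inl p @ Inr a # map Inl q"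
proof (induction u)
  case (Cons x u)
  show ?case
  proof (cases x)
    case (Inl b)
    then obtain p a q where "u = map Inl p @ Inr a # map Inl q" using Cons by auto
    then have "x # u = map Inl (b # p) @ Inr a # map Inl q" using Inl by simp
    then show ?thesis by blast
  next
    case (Inr b)
    then obtain q where "u = map Inl q" using Cons num_dirs_eq_0[of u] by auto
    then have "x # u = map Inl [] @ Inr b # map Inl q" using Inr by simp
    then show ?thesis by blast
  qed
qed auto

lemma free_deriv_leibniz:
  "free_deriv (f * g) = free_deriv f * nc_embed g + nc_embed f * free_deriv g"
proof (rule ncps_eqI)
  fix u :: "('a + 'a) list"
  have *: "num_dirs u = num_dirs (take i u) + num_dirs (drop i u)" for i
    by (metis append_take_drop_id num_dirs_simps(4))
  let ?c = "\<lambda>(f :: 'a ncps) u. nc_coeff f (map (case_sum id id) u)"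
  have "nc_coeff (free_deriv (f * g)) u
      = (\<Sum>i\<le>length u. if num_dirs u = 1 then ?c f (take i u) * ?c g (drop i u) else 0)"
    by (simp add: free_deriv_def nc_coeff_times take_map drop_map)
  also have "\<dots> = (\<Sum>i\<le>length u.
        nc_coeff (free_deriv f) (take i u) * nc_coeff (nc_embed g) (drop i u)
      + nc_coeff (nc_embed f) (take i u) * nc_coeff (free_deriv g) (drop i u))"
  proof (rule sum.cong[OF refl])
    fix i
    show "(if num_dirs u = 1 then ?c f (take i u) * ?c g (drop i u) else 0)
      = nc_coeff (free_deriv f) (take i u) * nc_coeff (nc_embed g) (drop i u)
      + nc_coeff (nc_embed f) (take i u) * nc_coeff (free_deriv g) (drop i u)"
      using *[of i] by (auto simp: free_deriv_def nc_embed_def)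
  qed
  also have "\<dots> = nc_coeff (free_deriv f * nc_embed g + nc_embed f * free_deriv g) u"
    by (simp add: nc_coeff_times sum.distrib)
  finally show "nc_coeff (free_deriv (f * g)) u
      = nc_coeff (free_deriv f * nc_embed g + nc_embed f * free_deriv g) u" .
qed

lemma free_deriv_var: "free_deriv (nc_var a) = nc_var (Inr a)"
proof (rule ncps_eqI)
  fix u :: "('a + 'a) list"
  have "num_dirs u = 1 \<and> map (case_sum id id) u = [a] \<longleftrightarrow> u = [Inr a]"
  proof
    assume u: "num_dirs u = 1 \<and> map (case_sum id id) u = [a]"
    then obtain b where "u = [b]" by auto
    with u show "u = [Inr a]" by (cases b) auto
  qed auto
  then show "nc_coeff (free_deriv (nc_var a)) u = nc_coeff (nc_var (Inr a)) u"
    by (auto simp: free_deriv_def nc_coeff_var)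
qed

lemma is_free_derivation_free_deriv: "is_free_derivation free_deriv"
  unfolding is_free_derivation_def
proof (intro conjI allI)
  fix N
  show "\<exists>M. \<forall>f::'a ncps. (\<forall>w. length w < M \<longrightarrow> nc_coeff f w = 0) \<longrightarrow>
          (\<forall>u. length u < N \<longrightarrow> nc_coeff (free_deriv f) u = 0)"
    by (rule exI[of _ N]) (auto simp: free_deriv_def)
qed (simp_all add: free_deriv_leibniz[symmetric] free_deriv_var,
     auto simp: ncps_eq_iff free_deriv_def)

lemma nc_embed_1: "nc_embed 1 = 1"
  by (auto simp: ncps_eq_iff nc_embed_def nc_coeff_one)

lemma nc_truncation:
  fixes f :: "'a::finite ncps"
  assumes "length v < M"
  shows "nc_coeff (\<Sum>w | length w \<le> M. nc_const (nc_coeff f w) * prod_list (map nc_var w)) v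
       = nc_coeff f v"
proof -
  have "nc_coeff (\<Sum>w | length w \<le> M. nc_const (nc_coeff f w) * prod_list (map nc_var w)) v
      = (\<Sum>w | length w \<le> M. if w = v then nc_coeff f v else 0)"
    by (auto simp: nc_coeff_monom intro!: sum.cong)
  then show ?thesis using assms finite_words_length_le[where 'a = 'a, of M] by simp
qed

lemma is_free_derivation_sum:
  assumes "is_free_derivation D" "finite A"
  shows "D (sum F A) = (\<Sum>a\<in>A. D (F a))"
proof -
  have add: "D (f + g) = D f + D g" for f g
    using assms(1) by (simp add: is_free_derivation_def)
  have "D 0 = 0" using add[of 0 0] by simp
  with assms(2) show ?thesis by (induction A) (auto simp: add)
qed

lemma is_free_derivation_monom:
  assumes "is_free_derivation D"
  shows "D (prod_list (map nc_var w)) = free_deriv (prod_list (map nc_var w))"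
proof (induction w)
  case Nil
  have *: "D' 1 = 0" if "is_free_derivation D'" for D' :: "'a ncps \<Rightarrow> ('a + 'a) ncps"
  proof -
    have "D' (1 * 1) = D' 1 * nc_embed 1 + nc_embed 1 * D' 1"
      using that unfolding is_free_derivation_def by blast
    then show ?thesis by (simp add: nc_embed_1)
  qed
  show ?case using *[OF assms] *[OF is_free_derivation_free_deriv] by simp
next
  case (Cons a w)
  have "D (nc_var a * prod_list (map nc_var w))
      = nc_var (Inr a) * nc_embed (prod_list (map nc_var w))
        + nc_embed (nc_var a) * D (prod_list (map nc_var w))"
    using assms by (simp add: is_free_derivation_def)
  then show ?case by (simp add: Cons.IH free_deriv_leibniz free_deriv_var)
qed

theorem is_free_derivation_iff:
  fixes D :: "'a::finite ncps \<Rightarrow> ('a + 'a) ncps"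
  shows "is_free_derivation D \<longleftrightarrow> D = free_deriv"
proof
  assume D: "is_free_derivation D"
  show "D = free_deriv"
  proof (intro ext ncps_eqI)
    fix f :: "'a ncps" and u :: "('a + 'a) list"
    have "\<exists>M. \<forall>f. (\<forall>w. length w < M \<longrightarrow> nc_coeff f w = 0) \<longrightarrow>
              (\<forall>v. length v < Suc (length u) \<longrightarrow> nc_coeff (D f) v = 0)"
      using D unfolding is_free_derivation_def by blast
    then obtain M where M: "\<And>f. (\<forall>w. length w < M \<longrightarrow> nc_coeff f w = 0) \<Longrightarrow> nc_coeff (D f) u = 0"
      by blast
    define K where "K = max M (Suc (length u))"
    define t where "t = (\<Sum>w | length w \<le> K. nc_const (nc_coeff f w) * prod_list (map nc_var w))"
    have t: "nc_coeff (f - t) v = 0" if "length v < K" for v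
      using nc_truncation[OF that, of f] by (simp add: t_def)
    have add: "D (t + (f - t)) = D t + D (f - t)"
      and scale: "\<And>c f. D (nc_const c * f) = nc_const c * D f"
      using D unfolding is_free_derivation_def by blast+
    note E = is_free_derivation_free_deriv[where 'a = 'a]
    have scale': "\<And>c f. free_deriv (nc_const c * f :: 'a ncps) = nc_const c * free_deriv f"
      and add': "free_deriv (t + (f - t)) = free_deriv t + free_deriv (f - t)"
      using E unfolding is_free_derivation_def by blast+
    have "D t = free_deriv t"
      unfolding t_def is_free_derivation_sum[OF D finite_words_length_le]
        is_free_derivation_sum[OF E finite_words_length_le] scale scale'
        is_free_derivation_monom[OF D] ..
    moreover have "nc_coeff (D (f - t)) u = 0"
      by (rule M) (use t in \<open>auto simp: K_def\<close>)
    moreover have "nc_coeff (free_deriv (f - t)) u = 0"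
      using t[of "map (case_sum id id) u"] by (auto simp: free_deriv_def K_def)
    ultimately show "nc_coeff (D f) u = nc_coeff (free_deriv f) u"
      using add add' by simp
  qed
qed (simp add: is_free_derivation_free_deriv)

text \<open>The derivative with the indeterminates kept and the direction variable of each letter \<open>a\<close>
  specialised to the scalar \<open>d a\<close>.  As \<open>free_deriv f\<close> is homogeneous of degree one in the direction
  variables, the substitution is locally finite although constants are substituted; see
  \<open>nc_coeff_deriv_at\<close>.\<close>

definition nc_deriv_at :: "'a ncps \<Rightarrow> ('a \<Rightarrow> complex) \<Rightarrow> 'a ncps" where
  "nc_deriv_at f d = nc_subst (free_deriv f) (case_sum nc_var (\<lambda>a. nc_const (d a)))"

lemma nc_deriv_at_term:
  fixes d :: "'a \<Rightarrow> complex"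
  shows "nc_coeff (prod_list (map (case_sum nc_var (\<lambda>a. nc_const (d a)))
           (map Inl p @ Inr a # map Inl q))) w = (if w = p @ q then d a else 0)"
proof -
  have "nc_coeff (prod_list (map (case_sum nc_var (\<lambda>a. nc_const (d a)))
           (map Inl p @ Inr a # map Inl q))) w
      = nc_coeff (prod_list (map nc_var p) * (nc_const (d a) * prod_list (map nc_var q))) w"
    by (simp add: comp_def)
  also have "\<dots> = (if take (length p) w = p then d a * (if drop (length p) w = q then 1 else 0) else 0)"
    by (simp add: nc_coeff_monom_times nc_coeff_monom)
  also have "\<dots> = (if w = p @ q then d a else 0)"
    by (auto simp: append_eq_conv_conj)
       (metis append_take_drop_id)+
  finally show ?thesis .
qed

theorem nc_coeff_deriv_at:
  fixes f :: "'a::finite ncps"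
  shows "nc_coeff (nc_deriv_at f d) w
       = (\<Sum>k\<le>length w. \<Sum>a\<in>UNIV. nc_coeff f (take k w @ a # drop k w) * d a)"
proof -
  define s :: "'a + 'a \<Rightarrow> 'a ncps" where "s = case_sum nc_var (\<lambda>a. nc_const (d a))"
  define h :: "nat \<times> 'a \<Rightarrow> ('a + 'a) list"
    where "h = (\<lambda>(k, a). map Inl (take k w) @ Inr a # map Inl (drop k w))"
  let ?A = "{..length w} \<times> (UNIV :: 'a set)"
  let ?F = "\<lambda>u. nc_coeff (free_deriv f) u * nc_coeff (prod_list (map s u)) w"
  have sub: "{u. ?F u \<noteq> 0} \<subseteq> h ` ?A"
  proof
    fix u assume "u \<in> {u. ?F u \<noteq> 0}"
    then have u: "nc_coeff (free_deriv f) u \<noteq> 0" "nc_coeff (prod_list (map s u)) w \<noteq> 0" by auto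
    then have "num_dirs u = 1" by (auto simp: free_deriv_def split: if_splits)
    then obtain p a q where pq: "u = map Inl p @ Inr a # map Inl q" using num_dirs_eq_1 by blast
    with u(2) have "w = p @ q"
      unfolding s_def by (simp only: nc_deriv_at_term split: if_splits)
    then have "u = h (length p, a)" "(length p, a) \<in> ?A" by (auto simp: h_def pq)
    then show "u \<in> h ` ?A" by blast
  qed
  have inj: "inj_on h ?A"
  proof (rule inj_onI)
    fix x y assume xy: "x \<in> ?A" "y \<in> ?A" "h x = h y"
    obtain k a l b where [simp]: "x = (k, a)" "y = (l, b)" by (cases x, cases y) auto
    have len: "length (takeWhile isl (h (k, a))) = k" if "k \<le> length w" for k a
      unfolding h_def prod.case
      by (subst takeWhile_append2) (use that in auto)
    have "k = l" using xy len[of k a] len[of l b] by auto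
    then show "x = y" using xy(3) by (auto simp: h_def)
  qed
  have "nc_coeff (nc_deriv_at f d) w = Sum_any ?F"
    by (simp add: nc_deriv_at_def nc_subst_def s_def)
  also have "\<dots> = sum ?F (h ` ?A)"
    by (rule Sum_any.expand_superset[OF _ sub]) auto
  also have "\<dots> = (\<Sum>x\<in>?A. ?F (h x))"
    using sum.reindex[OF inj, of ?F] by (simp add: comp_def)
  also have "\<dots> = (\<Sum>(k, a)\<in>?A. nc_coeff f (take k w @ a # drop k w) * d a)"
  proof (rule sum.cong[OF refl], clarify)
    fix k a
    have "nc_coeff (prod_list (map s (h (k, a)))) w = d a"
      unfolding s_def h_def prod.case nc_deriv_at_term by simp
    moreover have "nc_coeff (free_deriv f) (h (k, a)) = nc_coeff f (take k w @ a # drop k w)"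
      by (simp add: free_deriv_def h_def comp_def)
    ultimately show "?F (h (k, a)) = nc_coeff f (take k w @ a # drop k w) * d a" by simp
  qed
  finally show ?thesis by (simp add: sum.cartesian_product)
qed

section \<open>Systems in the letters \<open>x\<close> and \<open>z\<close>\<close>

text \<open>The letters \<open>x\<^sub>1, \<dots>, x\<^sub>g, z\<^sub>1, \<dots>, z\<^sub>h\<close> form the type \<open>'g + 'h\<close>, with \<open>Inl i\<close> for \<open>x\<^sub>i\<close> and \<open>Inr j\<close> for
  \<open>z\<^sub>j\<close>, where \<open>g = CARD('g)\<close> and \<open>h = CARD('h)\<close>.  The matrix \<open>deriv_z f\<close> is \<open>\<partial>f/\<partial>z\<close>: its \<open>(i, j)\<close> entry is
  the derivative of \<open>f\<^sub>i\<close> in the direction \<open>0\<close> for \<open>x\<close> and \<open>e\<^sub>j\<close> for \<open>z\<close>.\<close>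

definition deriv_z :: "('g + 'h) ncps ^ 'h \<Rightarrow> ('g + 'h) ncps ^ 'h ^ 'h" where
  "deriv_z f = (\<chi> i j. nc_deriv_at (f $ i) (case_sum (\<lambda>_. 0) (\<lambda>k. axis j 1 $ k)))"

text \<open>The system \<open>f(x, g(x))\<close>.\<close>

definition subst_z :: "('g + 'h) ncps ^ 'h \<Rightarrow> 'g ncps ^ 'h \<Rightarrow> 'g ncps ^ 'h" where
  "subst_z f g = (\<chi> i. nc_subst (f $ i) (case_sum nc_var (\<lambda>j. g $ j)))"

definition eval0_vec :: "'a ncps ^ 'n \<Rightarrow> complex ^ 'n" where
  "eval0_vec f = (\<chi> i. nc_eval0 (f $ i))"

definition eval0_mat :: "'a ncps ^ 'n ^ 'm \<Rightarrow> complex ^ 'n ^ 'm" where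
  "eval0_mat A = (\<chi> i j. nc_eval0 (A $ i $ j))"

lemma eval0_deriv_z:
  fixes f :: "('g::finite + 'h::finite) ncps ^ 'h"
  shows "eval0_mat (deriv_z f) $ i $ j = nc_coeff (f $ i) [Inr j]"
proof -
  have "eval0_mat (deriv_z f) $ i $ j
      = (\<Sum>a\<in>UNIV. nc_coeff (f $ i) [a] * case_sum (\<lambda>_. 0) (\<lambda>k. axis j 1 $ k) a)"
    by (simp add: eval0_mat_def deriv_z_def nc_eval0_def nc_coeff_deriv_at)
  also have "\<dots> = (\<Sum>a\<in>UNIV. if a = Inr j then nc_coeff (f $ i) [a] else 0)"
    by (rule sum.cong) (auto simp: axis_def split: sum.splits)
  finally show ?thesis by simp
qed

end

theory Submission
  imports Defs
begin

text \<open>Put \<open>A = \<partial>f/\<partial>z(0,0)\<close>.  Since \<open>A\<close> is invertible, \<open>f(x, g) = 0\<close> says that \<open>g\<close> is a fixed point of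
  the simplified Newton map \<open>T(g) = g - A\<^sup>-\<^sup>1 f(x, g)\<close>, with the Jacobian fixed at the origin.
  This map is a contraction for the degree filtration on the series without constant term: if \<open>g\<close>
  and \<open>g'\<close> agree on all words shorter than \<open>n\<close>, then \<open>f(x, g)\<close> and \<open>f(x, g')\<close> differ on words of
  length at most \<open>n\<close> only through the terms of \<open>f\<close> of degree one, that is, by \<open>A (g - g')\<close>
  (\<open>coeff_vec_subst_z_diff\<close>).  The reason is that a product of two or more series without constant
  term involves, in degree \<open>n\<close>, only coefficients of its factors in degrees below \<open>n\<close>
  (\<open>nc_coeff_monomial_subst_cong\<close>).  Hence \<open>T(g)\<close> and \<open>T(g')\<close> agree on words of length \<open>n\<close> as well, and
  iteration of \<open>T\<close> determines one fixed point, degree by degree (\<open>ncps_vec_contraction\<close>).\<close>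

lemma nc_coeff_prod_list_cong:
  assumes "\<And>a v. length v \<le> length w \<Longrightarrow> nc_coeff (s a) v = nc_coeff (t a) v"
  shows "nc_coeff (prod_list (map s u)) w = nc_coeff (prod_list (map t u)) w"
  using assms
proof (induction u arbitrary: w)
  case (Cons a u)
  have "nc_coeff (prod_list (map s u)) (drop i w) = nc_coeff (prod_list (map t u)) (drop i w)" for i
    by (rule Cons.IH) (use Cons.prems in auto)
  then show ?case
    using Cons.prems by (simp add: nc_coeff_times)
qed simp

text \<open>In the Cauchy product of the first factor with the others, the two trivial factorisations of \<open>w\<close>
  contribute a vanishing constant term, and all the others involve only words shorter than \<open>w\<close>.
  With just one factor this fails: the coefficient at \<open>w\<close> itself enters.\<close>

lemma nc_coeff_monomial_subst_cong:
  assumes s0: "\<And>a. nc_eval0 (s a) = 0" and t0: "\<And>a. nc_eval0 (t a) = 0"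
    and st: "\<And>a v. length v < length w \<Longrightarrow> nc_coeff (s a) v = nc_coeff (t a) v"
    and u: "length u \<noteq> 1"
  shows "nc_coeff (prod_list (map s u)) w = nc_coeff (prod_list (map t u)) w"
proof (cases u)
  case (Cons a v)
  with u have "v \<noteq> []" by auto
  have "nc_coeff (s a) (take i w) * nc_coeff (prod_list (map s v)) (drop i w)
      = nc_coeff (t a) (take i w) * nc_coeff (prod_list (map t v)) (drop i w)"
    if i: "i \<le> length w" for i
  proof -
    consider "i = 0" | "i = length w" | "0 < i" "i < length w" using i by linarith
    then show ?thesis
    proof cases
      case 1
      then show ?thesis using s0[of a] t0[of a] by (simp add: nc_eval0_def)
    next
      case 2
      have "nc_coeff (prod_list (map s v)) [] = 0" "nc_coeff (prod_list (map t v)) [] = 0"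
        using \<open>v \<noteq> []\<close> by (auto intro: nc_coeff_prod_list_eq_0 s0 t0)
      with 2 show ?thesis by simp
    next
      case 3
      then have "nc_coeff (prod_list (map s v)) (drop i w)
          = nc_coeff (prod_list (map t v)) (drop i w)"
        by (intro nc_coeff_prod_list_cong st) auto
      with 3 show ?thesis using st[of "take i w" a] by simp
    qed
  qed
  then show ?thesis by (simp add: Cons nc_coeff_times)
qed simp

lemma nc_coeff_subst_diff:
  fixes f :: "'a::finite ncps"
  assumes s0: "\<And>a. nc_eval0 (s a) = 0" and t0: "\<And>a. nc_eval0 (t a) = 0"
    and st: "\<And>a v. length v < length w \<Longrightarrow> nc_coeff (s a) v = nc_coeff (t a) v"
  shows "nc_coeff (nc_subst f s) w - nc_coeff (nc_subst f t) w
       = (\<Sum>a\<in>UNIV. nc_coeff f [a] * (nc_coeff (s a) w - nc_coeff (t a) w))"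
proof -
  let ?P = "\<lambda>u. nc_coeff f u * (nc_coeff (prod_list (map s u)) w - nc_coeff (prod_list (map t u)) w)"
  let ?U = "{u :: 'a list. length u \<le> Suc (length w)}"
  \<comment> \<open>One degree more than necessary is summed, so that all letters are included even if \<open>w\<close> is empty.\<close>
  have extend: "nc_coeff (nc_subst f r) w
      = (\<Sum>u\<in>?U. nc_coeff f u * nc_coeff (prod_list (map r u)) w)"
    if r0: "\<And>a. nc_eval0 (r a) = 0" for r :: "'a \<Rightarrow> 'b ncps"
    unfolding nc_coeff_subst[of r, OF r0]
    by (rule sum.mono_neutral_left[OF finite_words_length_le])
       (auto simp: nc_coeff_prod_list_eq_0[of r, OF r0])
  have "nc_coeff (nc_subst f s) w - nc_coeff (nc_subst f t) w = sum ?P ?U"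
    by (simp add: extend s0 t0 right_diff_distrib sum_subtractf)
  also have "\<dots> = sum ?P ((\<lambda>a. [a]) ` UNIV)"
  proof (rule sum.mono_neutral_right[OF finite_words_length_le])
    show "\<forall>u \<in> ?U - range (\<lambda>a. [a]). ?P u = 0"
    proof
      fix u assume "u \<in> ?U - range (\<lambda>a. [a])"
      then have "length u \<noteq> 1" by (auto simp: length_Suc_conv)
      then show "?P u = 0"
        using nc_coeff_monomial_subst_cong[of s t w u, OF s0 t0 st] by simp
    qed
  qed auto
  also have "\<dots> = (\<Sum>a\<in>UNIV. ?P [a])"
    by (subst sum.reindex) (auto simp: inj_on_def)
  finally show ?thesis by simp
qed

definition coeff_vec :: "'a ncps ^ 'n \<Rightarrow> 'a list \<Rightarrow> complex ^ 'n" where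
  "coeff_vec g w = (\<chi> i. nc_coeff (g $ i) w)"

lemma eval0_vec_eq_coeff_vec: "eval0_vec g = coeff_vec g []"
  by (simp add: eval0_vec_def coeff_vec_def nc_eval0_def)

lemma ncps_vec_eqI: "(\<And>w. coeff_vec g w = coeff_vec g' w) \<Longrightarrow> g = g'"
  by (simp add: vec_eq_iff coeff_vec_def ncps_eq_iff)

lemma coeff_vec_surj: "\<exists>g. \<forall>w. coeff_vec g w = c w"
proof (intro exI allI)
  show "coeff_vec (\<chi> i. Abs_ncps (\<lambda>w. c w $ i)) w = c w" for w
    by (simp add: coeff_vec_def)
qed

definition agree_below :: "nat \<Rightarrow> 'a ncps ^ 'n \<Rightarrow> 'a ncps ^ 'n \<Rightarrow> bool" where
  "agree_below n g g' \<longleftrightarrow> (\<forall>w. length w < n \<longrightarrow> coeff_vec g w = coeff_vec g' w)"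

text \<open>This is the Banach fixed point theorem for the degree filtration.  The coefficient of the fixed
  point at \<open>w\<close> is read off from the iterate of index \<open>length w\<close>, from which on it no longer changes;
  the vanishing constant terms account for degree \<open>0\<close>.\<close>

lemma ncps_vec_contraction:
  fixes T :: "'a ncps ^ 'n \<Rightarrow> 'a ncps ^ 'n"
  assumes T0: "\<And>g. eval0_vec g = 0 \<Longrightarrow> eval0_vec (T g) = 0"
    and contr: "\<And>g g' n. eval0_vec g = 0 \<Longrightarrow> eval0_vec g' = 0 \<Longrightarrow>
                  agree_below n g g' \<Longrightarrow> agree_below (Suc n) (T g) (T g')"
  shows "\<exists>!g. eval0_vec g = 0 \<and> T g = g"
proof -
  define G where "G n = (T ^^ n) 0" for n
  have G_Suc: "G (Suc n) = T (G n)" for n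
    by (simp add: G_def)
  have G0: "eval0_vec (G n) = 0" for n
  proof (induction n)
    case 0
    show ?case by (simp add: G_def eval0_vec_def nc_eval0_def vec_eq_iff)
  qed (simp add: G_Suc T0)
  have step: "agree_below (Suc n) (G (Suc n)) (G n)" for n
  proof (induction n)
    case 0
    show ?case using G0[of 0] G0[of 1] by (simp add: agree_below_def eval0_vec_eq_coeff_vec)
  next
    case (Suc n)
    show ?case using contr[OF G0 G0 Suc] by (simp add: G_Suc)
  qed
  have stable: "coeff_vec (G n) w = coeff_vec (G (length w)) w" if "length w \<le> n" for n w
    using that
  proof (induction n rule: dec_induct)
    case (step n)
    then show ?case using \<open>agree_below (Suc n) (G (Suc n)) (G n)\<close> by (simp add: agree_below_def)
  qed simp
  obtain g where g: "\<And>w. coeff_vec g w = coeff_vec (G (length w)) w"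
    using coeff_vec_surj[of "\<lambda>w. coeff_vec (G (length w)) w"] by auto
  have g0: "eval0_vec g = 0"
    using G0[of 0] by (simp add: eval0_vec_eq_coeff_vec g)
  have "T g = g"
  proof (rule ncps_vec_eqI)
    fix w :: "'a list"
    have "agree_below (Suc (length w)) g (G (length w))"
      unfolding agree_below_def g using stable[of _ "length w"] by auto
    then have "agree_below (Suc (Suc (length w))) (T g) (G (Suc (length w)))"
      unfolding G_Suc by (rule contr[OF g0 G0])
    then have "coeff_vec (T g) w = coeff_vec (G (Suc (length w))) w"
      by (simp add: agree_below_def)
    also have "\<dots> = coeff_vec g w" unfolding g by (rule stable) simp
    finally show "coeff_vec (T g) w = coeff_vec g w" .
  qed
  moreover have "g' = g" if "eval0_vec g' = 0" "T g' = g'" for g'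
  proof -
    have "agree_below n g' g" for n
    proof (induction n)
      case (Suc n)
      show ?case using contr[OF that(1) g0 Suc] that(2) \<open>T g = g\<close> by simp
    qed (simp add: agree_below_def)
    then show ?thesis by (intro ncps_vec_eqI) (auto simp: agree_below_def)
  qed
  ultimately show ?thesis using g0 by blast
qed

text \<open>Only the linear words of \<open>f\<close> see the coefficients at \<open>w\<close>, and among these the letters \<open>x\<^sub>i\<close> cancel,
  since the same series is substituted for them on both sides; the letters \<open>z\<^sub>j\<close> give the Jacobian.\<close>

lemma coeff_vec_subst_z_diff:
  fixes f :: "('g::finite + 'h::finite) ncps ^ 'h" and g g' :: "'g ncps ^ 'h"
  assumes "eval0_vec g = 0" "eval0_vec g' = 0" "agree_below n g g'" "length w \<le> n"
  shows "coeff_vec (subst_z f g) w - coeff_vec (subst_z f g') w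
       = eval0_mat (deriv_z f) *v (coeff_vec g w - coeff_vec g' w)"
proof -
  let ?s = "\<lambda>g :: 'g ncps ^ 'h. case_sum nc_var (\<lambda>j. g $ j)"
  have s0: "nc_eval0 (?s g a) = 0" if "eval0_vec g = 0" for g :: "'g ncps ^ 'h" and a
    using that by (auto simp: nc_eval0_def nc_coeff_var eval0_vec_def vec_eq_iff split: sum.splits)
  have agree: "nc_coeff (?s g a) v = nc_coeff (?s g' a) v" if "length v < length w" for a v
    using assms(3,4) that
    by (auto simp: agree_below_def coeff_vec_def vec_eq_iff split: sum.splits)
  have "nc_coeff (subst_z f g $ i) w - nc_coeff (subst_z f g' $ i) w
      = (\<Sum>j\<in>UNIV. nc_coeff (f $ i) [Inr j] * (nc_coeff (g $ j) w - nc_coeff (g' $ j) w))" for i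
  proof -
    have "nc_coeff (subst_z f g $ i) w - nc_coeff (subst_z f g' $ i) w
        = (\<Sum>a\<in>UNIV. nc_coeff (f $ i) [a] * (nc_coeff (?s g a) w - nc_coeff (?s g' a) w))"
      using nc_coeff_subst_diff[of "?s g" "?s g'" w "f $ i", OF s0[OF assms(1)] s0[OF assms(2)] agree]
      by (simp add: subst_z_def)
    also have "\<dots> = (\<Sum>a\<in>UNIV <+> UNIV.
        nc_coeff (f $ i) [a] * (nc_coeff (?s g a) w - nc_coeff (?s g' a) w))"
      by simp
    also have "\<dots> = (\<Sum>j\<in>UNIV. nc_coeff (f $ i) [Inr j] * (nc_coeff (g $ j) w - nc_coeff (g' $ j) w))"
      by (subst sum.Plus) auto
    finally show ?thesis .
  qed
  then show ?thesis
    by (simp add: vec_eq_iff coeff_vec_def matrix_vector_mult_def eval0_deriv_z)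
qed

lemma eval0_subst_z:
  fixes f :: "('g::finite + 'h::finite) ncps ^ 'h"
  assumes "eval0_vec g = 0"
  shows "eval0_vec (subst_z f g) = eval0_vec f"
proof -
  have "nc_eval0 (case_sum nc_var (\<lambda>j. g $ j) a) = 0" for a
    using assms by (auto simp: nc_eval0_def nc_coeff_var eval0_vec_def vec_eq_iff split: sum.splits)
  then show ?thesis
    by (simp add: eval0_vec_def nc_eval0_def vec_eq_iff subst_z_def nc_coeff_subst nc_coeff_one)
qed

theorem theorem4p8:
  fixes f :: "('g::finite + 'h::finite) ncps ^ 'h"
  assumes "eval0_vec f = 0"
    and "invertible (eval0_mat (deriv_z f))"
  shows "\<exists>!g :: 'g ncps ^ 'h. eval0_vec g = 0 \<and> subst_z f g = 0"
proof -
  obtain B where BA: "B ** eval0_mat (deriv_z f) = mat 1" and AB: "eval0_mat (deriv_z f) ** B = mat 1"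
    using assms(2) unfolding invertible_def by blast
  have "\<exists>h. \<forall>w. coeff_vec h w = coeff_vec g w - B *v coeff_vec (subst_z f g) w"
    for g :: "'g ncps ^ 'h"
    by (rule coeff_vec_surj)
  then obtain T :: "'g ncps ^ 'h \<Rightarrow> 'g ncps ^ 'h"
    where T: "\<And>g w. coeff_vec (T g) w = coeff_vec g w - B *v coeff_vec (subst_z f g) w"
    by metis
  have "T g = g \<longleftrightarrow> subst_z f g = 0" for g
  proof -
    have B_eq_0: "B *v v = 0 \<longleftrightarrow> v = 0" for v
      by (metis AB matrix_vector_mul_assoc matrix_vector_mul_lid matrix_vector_mult_0_right)
    have zero: "coeff_vec (0 :: 'g ncps ^ 'h) w = 0" for w
      by (simp add: coeff_vec_def vec_eq_iff)
    have "T g = g \<longleftrightarrow> (\<forall>w. coeff_vec (T g) w = coeff_vec g w)"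
      using ncps_vec_eqI by metis
    also have "\<dots> \<longleftrightarrow> (\<forall>w. coeff_vec (subst_z f g) w = coeff_vec 0 w)"
      by (simp add: T B_eq_0 zero)
    also have "\<dots> \<longleftrightarrow> subst_z f g = 0"
      using ncps_vec_eqI by metis
    finally show ?thesis .
  qed
  moreover have "\<exists>!g. eval0_vec g = 0 \<and> T g = g"
  proof (rule ncps_vec_contraction)
    show "eval0_vec (T g) = 0" if "eval0_vec g = 0" for g
      using eval0_subst_z[OF that, of f] that assms(1) by (simp add: eval0_vec_eq_coeff_vec T)
    show "agree_below (Suc n) (T g) (T g')"
      if g: "eval0_vec g = 0" "eval0_vec g' = 0" "agree_below n g g'" for g g' n
      unfolding agree_below_def
    proof (intro allI impI)
      fix w :: "'g list" assume "length w < Suc n"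
      let ?d = "coeff_vec g w - coeff_vec g' w"
      have "coeff_vec (T g) w - coeff_vec (T g') w
          = ?d - B *v (coeff_vec (subst_z f g) w - coeff_vec (subst_z f g') w)"
        by (simp add: T matrix_vector_mult_diff_distrib)
      also have "\<dots> = ?d - (B ** eval0_mat (deriv_z f)) *v ?d"
        using coeff_vec_subst_z_diff[OF g, of w f] \<open>length w < Suc n\<close>
        by (simp add: matrix_vector_mul_assoc)
      also have "\<dots> = 0" by (simp add: BA)
      finally show "coeff_vec (T g) w = coeff_vec (T g') w" by simp
    qed
  qed
  ultimately show ?thesis by simp
qed

end
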